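(* Let $(G,\circ)$ be an F-Lie group and let $\mathcal D_{\text{Pois}}$ be its Poisson-algebra distribution. Then $\mathcal D_{\text{Pois}}$ is closed under the product $\circ$: for any left-invariant vector fields $u^+,v^+\in\mathcal D_{\text{Pois}}$, the product $u^+\circ v^+$ also belongs to $\mathcal D_{\text{Pois}}$.
   Context: An F-manifold is a smooth manifold $M$ with a $C^\infty(M)$-bilinear, associative and commutative product $\circ$ on $\mathfrak X(M)$ such that the Leibnizator $$L(X,Y,Z):=[X,Y\circ Z]-[X,Y]\circ Z-Y\circ[X,Z]$$ satisfies the Hertling-Manin condition $L(X\circ Y,Z,W)=L(X,Z,W)\circ Y+X\circ L(Y,Z,W)$ for all vector fields $X,Y,Z,W$ (no unit for $\circ$ is required). An F-Lie group $(G,\circ)$ is an F-manifold whose underlying manifold $G$ is a simply connected Lie group and whose product $\circ$ is left-invariant, i.e. the product of two left-invariant vector fields is left-invariant. $\mathfrak X^+(G)$ is the space of left-invariant vector fields. Let $S$ be the symmetric $(1,2)$-tensor field $S(X,Y)=X\circ Y$. The Poisson-algebra distribution is $$\mathcal D_{\text{Pois}}:=\{u^+\in\mathfrak X^+(G):\mathcal L_{u^+}S=0\}=\{u^+\in\mathfrak X^+(G): L(u^+,v^+,w^+)=0\ \ \forall v^+,w^+\in\mathfrak X^+(G)\}.$$ *)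

theory Defs
  imports "HOL-Analysis.Analysis" "HOL-Algebra.Group" "HOL-Library.Function_Algebras"
begin

text \<open>Throughout, \<open>+\<close>, \<open>-\<close>, \<open>*\<close> and \<open>0\<close> on functions are the pointwise operations of
  \<^theory>\<open>HOL-Library.Function_Algebras\<close>.\<close>

text \<open>\<open>k\<close>-fold continuous differentiability on an open set, by iterating directional derivatives.
  This is the usual notion when the domain is finite-dimensional, which is the only case used.\<close>

primrec Ck_on :: "nat \<Rightarrow> 'e::real_normed_vector set \<Rightarrow> ('e \<Rightarrow> 'f::real_normed_vector) \<Rightarrow> bool" where
  "Ck_on 0 S f \<longleftrightarrow> continuous_on S f"
| "Ck_on (Suc k) S f \<longleftrightarrow>
     (\<forall>x\<in>S. f differentiable (at x)) \<and> (\<forall>v. Ck_on k S (\<lambda>x. frechet_derivative f (at x) v))"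

definition smooth_on :: "'e::real_normed_vector set \<Rightarrow> ('e \<Rightarrow> 'f::real_normed_vector) \<Rightarrow> bool" where
  "smooth_on S f \<longleftrightarrow> (\<forall>k. Ck_on k S f)"

text \<open>A manifold is a topological space with a (not necessarily maximal) smooth atlas; a chart is a
  pair of a domain and a coordinate map, the latter being relevant on the domain only.
  The model space is a finite-dimensional normed space rather than a type of class
  \<^class>\<open>euclidean_space\<close>, since the latter excludes dimension zero.\<close>

record ('a, 'e) manifold =
  mtop :: "'a topology"
  charts :: "('a set \<times> ('a \<Rightarrow> 'e)) set"

abbreviation points :: "('a, 'e, 'm) manifold_scheme \<Rightarrow> 'a set" where
  "points M \<equiv> topspace (mtop M)"

locale smooth_manifold =
  fixes M :: "('a, 'e::real_normed_vector) manifold"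
  assumes finite_dimensional: "\<exists>B::'e set. finite B \<and> span B = UNIV"
    and Hausdorff: "Hausdorff_space (mtop M)"
    and second_countable: "second_countable (mtop M)"
    and covers: "(\<Union>(U, \<phi>)\<in>charts M. U) = points M"
    and chart_openin: "(U, \<phi>) \<in> charts M \<Longrightarrow> openin (mtop M) U"
    and chart_open_image: "(U, \<phi>) \<in> charts M \<Longrightarrow> open (\<phi> ` U)"
    and chart_homeomorphic:
      "(U, \<phi>) \<in> charts M \<Longrightarrow> homeomorphic_map (subtopology (mtop M) U) (top_of_set (\<phi> ` U)) \<phi>"
    and charts_compatible:
      "(U, \<phi>) \<in> charts M \<Longrightarrow> (V, \<psi>) \<in> charts M \<Longrightarrow> smooth_on (\<phi> ` (U \<inter> V)) (\<psi> \<circ> inv_into U \<phi>)"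

definition smooth_map ::
  "('a, 'e::real_normed_vector) manifold \<Rightarrow> ('b, 'f::real_normed_vector) manifold \<Rightarrow> ('a \<Rightarrow> 'b) \<Rightarrow> bool" where
  "smooth_map M N f \<longleftrightarrow> continuous_map (mtop M) (mtop N) f \<and>
     (\<forall>(U, \<phi>)\<in>charts M. \<forall>(V, \<psi>)\<in>charts N.
        smooth_on (\<phi> ` (U \<inter> f -` V)) (\<psi> \<circ> f \<circ> inv_into U \<phi>))"

definition product_manifold ::
  "('a, 'e::real_normed_vector) manifold \<Rightarrow> ('b, 'f::real_normed_vector) manifold
    \<Rightarrow> ('a \<times> 'b, 'e \<times> 'f) manifold" where
  "product_manifold M N =
     \<lparr>mtop = prod_topology (mtop M) (mtop N),
      charts = {(U \<times> V, map_prod \<phi> \<psi>) | U \<phi> V \<psi>. (U, \<phi>) \<in> charts M \<and> (V, \<psi>) \<in> charts N}\<rparr>"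

definition real_line :: "(real, real) manifold" where
  "real_line = \<lparr>mtop = euclidean, charts = {(UNIV, id)}\<rparr>"

text \<open>Functions on \<open>M\<close> are total functions vanishing off the point set; this makes two of them equal
  iff they agree on \<open>M\<close>, and makes \<open>C\<^sup>\<infinity>(M)\<close> closed under pointwise operations.\<close>

definition smooth_functions :: "('a, 'e::real_normed_vector) manifold \<Rightarrow> ('a \<Rightarrow> real) set" where
  "smooth_functions M = {f. smooth_map M real_line f \<and> (\<forall>p. p \<notin> points M \<longrightarrow> f p = 0)}"

text \<open>Tangent vectors are point derivations of \<open>C\<^sup>\<infinity>(M)\<close>, set to zero on all other functions.\<close>

definition tangent_space ::
  "('a, 'e::real_normed_vector) manifold \<Rightarrow> 'a \<Rightarrow> (('a \<Rightarrow> real) \<Rightarrow> real) set" where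
  "tangent_space M p = {v.
     (\<forall>f. f \<notin> smooth_functions M \<longrightarrow> v f = 0) \<and>
     (\<forall>f\<in>smooth_functions M. \<forall>g\<in>smooth_functions M. v (f + g) = v f + v g) \<and>
     (\<forall>c. \<forall>f\<in>smooth_functions M. v (\<lambda>x. c * f x) = c * v f) \<and>
     (\<forall>f\<in>smooth_functions M. \<forall>g\<in>smooth_functions M. v (f * g) = f p * v g + g p * v f)}"

definition differential ::
  "('a, 'e::real_normed_vector) manifold \<Rightarrow> ('b, 'f::real_normed_vector) manifold \<Rightarrow> ('a \<Rightarrow> 'b)
    \<Rightarrow> (('a \<Rightarrow> real) \<Rightarrow> real) \<Rightarrow> (('b \<Rightarrow> real) \<Rightarrow> real)" where
  "differential M N F v =
     (\<lambda>f. if f \<in> smooth_functions N then v (\<lambda>x. if x \<in> points M then f (F x) else 0) else 0)"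

type_synonym 'a vfield = "'a \<Rightarrow> ('a \<Rightarrow> real) \<Rightarrow> real"

text \<open>For a vector field \<open>X\<close>, \<open>X p f\<close> is the derivative of \<open>f\<close> at \<open>p\<close> in the direction of \<open>X\<close>.\<close>

definition vector_fields :: "('a, 'e::real_normed_vector) manifold \<Rightarrow> 'a vfield set" where
  "vector_fields M = {X.
     (\<forall>p\<in>points M. X p \<in> tangent_space M p) \<and> (\<forall>p. p \<notin> points M \<longrightarrow> X p = 0) \<and>
     (\<forall>f\<in>smooth_functions M. (\<lambda>p. X p f) \<in> smooth_functions M)}"

definition fmult :: "('a \<Rightarrow> real) \<Rightarrow> 'a vfield \<Rightarrow> 'a vfield" where
  "fmult f X = (\<lambda>p g. f p * X p g)"

definition lie_bracket :: "'a vfield \<Rightarrow> 'a vfield \<Rightarrow> 'a vfield" where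
  "lie_bracket X Y = (\<lambda>p f. X p (\<lambda>q. Y q f) - Y p (\<lambda>q. X q f))"

text \<open>Lie derivative of a \<open>(1,2)\<close>-tensor field \<open>S\<close>, the latter regarded as a
  \<open>C\<^sup>\<infinity>(M)\<close>-bilinear map on vector fields.\<close>

definition lie_derivative ::
  "'a vfield \<Rightarrow> ('a vfield \<Rightarrow> 'a vfield \<Rightarrow> 'a vfield) \<Rightarrow> 'a vfield \<Rightarrow> 'a vfield \<Rightarrow> 'a vfield" where
  "lie_derivative X S =
     (\<lambda>Y Z. lie_bracket X (S Y Z) - S (lie_bracket X Y) Z - S Y (lie_bracket X Z))"

definition leibnizator ::
  "('a vfield \<Rightarrow> 'a vfield \<Rightarrow> 'a vfield) \<Rightarrow> 'a vfield \<Rightarrow> 'a vfield \<Rightarrow> 'a vfield \<Rightarrow> 'a vfield" where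
  "leibnizator m X Y Z = lie_bracket X (m Y Z) - m (lie_bracket X Y) Z - m Y (lie_bracket X Z)"

locale F_manifold = smooth_manifold M
  for M :: "('a, 'e::real_normed_vector) manifold" +
  fixes m :: "'a vfield \<Rightarrow> 'a vfield \<Rightarrow> 'a vfield" (infixl "\<odot>" 70)
  assumes closed: "\<lbrakk>X \<in> vector_fields M; Y \<in> vector_fields M\<rbrakk> \<Longrightarrow> X \<odot> Y \<in> vector_fields M"
    and add_left: "\<lbrakk>X \<in> vector_fields M; Y \<in> vector_fields M; Z \<in> vector_fields M\<rbrakk>
      \<Longrightarrow> (X + Y) \<odot> Z = X \<odot> Z + Y \<odot> Z"
    and add_right: "\<lbrakk>X \<in> vector_fields M; Y \<in> vector_fields M; Z \<in> vector_fields M\<rbrakk>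
      \<Longrightarrow> X \<odot> (Y + Z) = X \<odot> Y + X \<odot> Z"
    and fmult_left: "\<lbrakk>f \<in> smooth_functions M; X \<in> vector_fields M; Y \<in> vector_fields M\<rbrakk>
      \<Longrightarrow> fmult f X \<odot> Y = fmult f (X \<odot> Y)"
    and fmult_right: "\<lbrakk>f \<in> smooth_functions M; X \<in> vector_fields M; Y \<in> vector_fields M\<rbrakk>
      \<Longrightarrow> X \<odot> fmult f Y = fmult f (X \<odot> Y)"
    and assoc: "\<lbrakk>X \<in> vector_fields M; Y \<in> vector_fields M; Z \<in> vector_fields M\<rbrakk>
      \<Longrightarrow> (X \<odot> Y) \<odot> Z = X \<odot> (Y \<odot> Z)"
    and commute: "\<lbrakk>X \<in> vector_fields M; Y \<in> vector_fields M\<rbrakk> \<Longrightarrow> X \<odot> Y = Y \<odot> X"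
    and Hertling_Manin: "\<lbrakk>X \<in> vector_fields M; Y \<in> vector_fields M;
        Z \<in> vector_fields M; W \<in> vector_fields M\<rbrakk>
      \<Longrightarrow> leibnizator m (X \<odot> Y) Z W = leibnizator m X Z W \<odot> Y + X \<odot> leibnizator m Y Z W"

text \<open>The library constant \<^const>\<open>simply_connected\<close> only applies to subsets of normed spaces.\<close>

definition simply_connected_space :: "'a topology \<Rightarrow> bool" where
  "simply_connected_space X \<longleftrightarrow> path_connected_space X \<and>
     (\<forall>c. pathin X c \<and> c 1 = c 0 \<longrightarrow>
        homotopic_with (\<lambda>r. r 0 = c 0 \<and> r 1 = c 0) (top_of_set {0..1}) X c (\<lambda>_. c 0))"

locale Lie_group = group G + smooth_manifold M
  for G :: "'a monoid" (structure) and M :: "('a, 'e::real_normed_vector) manifold" +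
  assumes carrier_eq: "carrier G = points M"
    and smooth_mult: "smooth_map (product_manifold M M) M (\<lambda>(x, y). x \<otimes> y)"
    and smooth_inv: "smooth_map M M (\<lambda>x. inv x)"

definition left_invariant_fields ::
  "'a monoid \<Rightarrow> ('a, 'e::real_normed_vector) manifold \<Rightarrow> 'a vfield set" where
  "left_invariant_fields G M = {X \<in> vector_fields M.
     \<forall>g\<in>carrier G. \<forall>h\<in>carrier G. differential M M (\<lambda>x. g \<otimes>\<^bsub>G\<^esub> x) (X h) = X (g \<otimes>\<^bsub>G\<^esub> h)}"

locale F_Lie_group = Lie_group G M + F_manifold M m
  for G :: "'a monoid" (structure)
    and M :: "('a, 'e::real_normed_vector) manifold"
    and m :: "'a vfield \<Rightarrow> 'a vfield \<Rightarrow> 'a vfield" (infixl "\<odot>" 70) +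
  assumes simply_connected: "simply_connected_space (mtop M)"
    and left_invariant_product:
      "\<lbrakk>u \<in> left_invariant_fields G M; v \<in> left_invariant_fields G M\<rbrakk>
        \<Longrightarrow> u \<odot> v \<in> left_invariant_fields G M"

definition D_Pois ::
  "'a monoid \<Rightarrow> ('a, 'e::real_normed_vector) manifold \<Rightarrow> ('a vfield \<Rightarrow> 'a vfield \<Rightarrow> 'a vfield)
    \<Rightarrow> 'a vfield set" where
  "D_Pois G M m = {u \<in> left_invariant_fields G M.
     \<forall>Y\<in>vector_fields M. \<forall>Z\<in>vector_fields M. lie_derivative u m Y Z = 0}"

end

theory Submission
  imports Defs
begin

text \<open>Since the Lie derivative of the product along \<open>X\<close> is
  \<open>leibnizator m X\<close>, a left-invariant field lies in \<open>D_Pois\<close> iff its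
  leibnizator vanishes on all vector fields. For \<open>u\<close>, \<open>v\<close> in
  \<open>D_Pois\<close>, the Hertling-Manin condition makes that of \<open>u \<odot> v\<close> a sum
  of products with 0, hence 0; left-invariance is inherited from the product.\<close>

lemma lie_derivative_eq_leibnizator: "lie_derivative X m = leibnizator m X"
  by (simp add: lie_derivative_def leibnizator_def fun_eq_iff)

text \<open>Differentiating replaces \<open>c\<close> by the constant 0, so the induction must range
  over all constants.\<close>

lemma Ck_on_const: "Ck_on k S (\<lambda>x. c)"
  by (induction k arbitrary: c) (simp_all add: frechet_derivative_const)

lemma const_0_in_smooth_functions: "(\<lambda>p. 0) \<in> smooth_functions M"
  by (auto simp: smooth_functions_def smooth_map_def real_line_def smooth_on_def o_def Ck_on_const)

lemma zero_in_vector_fields: "0 \<in> vector_fields M"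
  by (auto simp: vector_fields_def tangent_space_def const_0_in_smooth_functions)

theorem proposition3p11:
  fixes G :: "'a monoid"
    and M :: "('a, 'e::real_normed_vector) manifold"
    and m :: "'a vfield \<Rightarrow> 'a vfield \<Rightarrow> 'a vfield" (infixl "\<odot>" 70)
    and u v :: "'a vfield"
  assumes "F_Lie_group G M m"
    and "u \<in> D_Pois G M m" and "v \<in> D_Pois G M m"
  shows "u \<odot> v \<in> D_Pois G M m"
proof -
  interpret F_Lie_group G M m by fact
  have u: "u \<in> left_invariant_fields G M" "u \<in> vector_fields M"
    and v: "v \<in> left_invariant_fields G M" "v \<in> vector_fields M"
    using assms(2,3) by (auto simp: D_Pois_def left_invariant_fields_def)
  \<comment> \<open>Additivity holds on vector fields only, so 0 must be known to be one; then
    expanding \<open>(0 + 0) \<odot> v\<close> and cancelling gives the claim.\<close>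
  have "0 \<odot> v = 0"
    using add_left[OF zero_in_vector_fields zero_in_vector_fields v(2)] by simp
  moreover have "u \<odot> 0 = 0"
    using add_right[OF u(2) zero_in_vector_fields zero_in_vector_fields] by simp
  ultimately have "leibnizator m (u \<odot> v) Y Z = 0"
    if "Y \<in> vector_fields M" "Z \<in> vector_fields M" for Y Z
    using Hertling_Manin[OF u(2) v(2) that] assms(2,3) that
    by (simp add: D_Pois_def lie_derivative_eq_leibnizator)
  then show ?thesis
    using left_invariant_product[OF u(1) v(1)]
    by (simp add: D_Pois_def lie_derivative_eq_leibnizator)
qed

end
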